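(* For all integers $i\geq 1$, $n\geq 0$ and all odd positive integers $r$, \begin{align*} \overline{OPT}_{2^i r}(8n+1)&\equiv 0\pmod{2^{i+1}},\\ \overline{OPT}_{2^i r}(4n+3)&\equiv 0\pmod{2^{i+3}},\\ \overline{OPT}_{2^i r}(8n+5)&\equiv 0\pmod{2^{i+2}}. \end{align*}
   Context: For a positive integer $m$ let $f_m:=(q^m;q^m)_\infty=\prod_{i\ge 1}(1-q^{mi})$ (as a formal power series in $q$). For a positive integer $k$ and integers $n\ge 0$, $\overline{OPT}_k(n)$ denotes the number of overpartition $k$-tuples of $n$ with all parts odd: $k$-tuples $(\xi_1,\dots,\xi_k)$ of overpartitions (partitions in which the first occurrence of each part size may be overlined) with all parts odd and total sum of all parts equal to $n$. Its generating function is $$\sum_{n\geq 0}\overline{OPT}_k(n)q^n=\frac{f_{2}^{3k}}{f_{1}^{2k}f_{4}^{k}}.$$ *)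

theory Defs
  imports "HOL-Library.Multiset" "HOL-Number_Theory.Cong"
begin

text \<open>
  An overpartition is a multiset of positive parts together with the set of those part sizes whose
  first occurrence is overlined; every part size that occurs may or may not be overlined.
\<close>

type_synonym overpartition = "nat multiset \<times> nat set"

definition is_overpartition :: "overpartition \<Rightarrow> bool" where
  "is_overpartition \<xi> \<longleftrightarrow> (\<forall>p\<in>#fst \<xi>. 0 < p) \<and> snd \<xi> \<subseteq> set_mset (fst \<xi>)"

definition all_parts_odd :: "overpartition \<Rightarrow> bool" where
  "all_parts_odd \<xi> \<longleftrightarrow> (\<forall>p\<in>#fst \<xi>. odd p)"

definition odd_overpartition_tuples :: "nat \<Rightarrow> nat \<Rightarrow> overpartition list set" where
  "odd_overpartition_tuples k n =
     {\<xi>s. length \<xi>s = k \<and> (\<forall>\<xi>\<in>set \<xi>s. is_overpartition \<xi> \<and> all_parts_odd \<xi>) \<and>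
          (\<Sum>\<xi>\<leftarrow>\<xi>s. sum_mset (fst \<xi>)) = n}"

definition OPT :: "nat \<Rightarrow> nat \<Rightarrow> nat" where
  "OPT k n = card (odd_overpartition_tuples k n)"

text \<open>The cardinality above is that of a finite set.\<close>

lemma size_le_sum_mset:
  fixes M :: "nat multiset"
  assumes "\<forall>p\<in>#M. 0 < p"
  shows "size M \<le> sum_mset M"
  using assms by (induction M) auto

lemma finite_odd_overpartition_tuples: "finite (odd_overpartition_tuples k n)"
proof -
  define A where "A = mset ` {xs. set xs \<subseteq> {..n} \<and> length xs \<le> n}"
  define B where "B = A \<times> Pow {..n}"
  have "finite A"
    unfolding A_def by (intro finite_imageI finite_lists_length_le) simp
  hence "finite B"
    unfolding B_def by simp
  have "\<xi> \<in> B" if "\<xi>s \<in> odd_overpartition_tuples k n" "\<xi> \<in> set \<xi>s" for \<xi> \<xi>s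
  proof -
    have op: "is_overpartition \<xi>" and s: "(\<Sum>\<xi>\<leftarrow>\<xi>s. sum_mset (fst \<xi>)) = n"
      using that by (auto simp: odd_overpartition_tuples_def)
    have le: "sum_mset (fst \<xi>) \<le> n"
      using member_le_sum_list[of "sum_mset (fst \<xi>)" "map (\<lambda>\<xi>. sum_mset (fst \<xi>)) \<xi>s"] that(2) s
      by auto
    have size: "size (fst \<xi>) \<le> n"
      using size_le_sum_mset[of "fst \<xi>"] op le by (auto simp: is_overpartition_def)
    have parts: "p \<le> n" if "p \<in># fst \<xi>" for p
      using sum_mset.remove[OF that] le by auto
    obtain xs where xs: "mset xs = fst \<xi>"
      using ex_mset by blast
    have "set xs \<subseteq> {..n}" "length xs \<le> n"
      using parts size by (auto simp flip: xs)
    hence "fst \<xi> \<in> A"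
      unfolding A_def using xs by (metis (mono_tags, lifting) image_eqI mem_Collect_eq)
    moreover have "snd \<xi> \<in> Pow {..n}"
      using op parts by (auto simp: is_overpartition_def)
    ultimately show ?thesis
      by (simp add: B_def mem_Times_iff)
  qed
  hence "odd_overpartition_tuples k n \<subseteq> {\<xi>s. set \<xi>s \<subseteq> B \<and> length \<xi>s = k}"
    by (auto simp: odd_overpartition_tuples_def)
  thus ?thesis
    using finite_lists_length_eq[OF \<open>finite B\<close>] finite_subset by blast
qed

end

(* Let A be the generating function for k = 1, the product of (1 + q^j) / (1 - q^j) over odd j.
   Its logarithmic derivative is q A' = 2 S A, where S is the sum of sigma(m) q^m over odd m.
   Hence n * OPT_k(n) is the coefficient of q^n in 2k S A^k. For even k, A^k = 1 mod 4, so for odd n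
   the 2-adic valuation of OPT_k(n) is at least that of 2k * gcd(4, sigma(n)). Pairing each
   divisor d with n/d gives 4 | sigma(n) if n = 3 mod 4 and 2 | sigma(n) if n = 5 mod 8. *)

theory Submission
  imports Defs "HOL-Computational_Algebra.Formal_Power_Series"
begin

unbundle fps_syntax

definition partitions_in :: "nat set \<Rightarrow> nat \<Rightarrow> nat multiset set" where
  "partitions_in P n = {M. set_mset M \<subseteq> P \<and> sum_mset M = n}"

text \<open>A partition underlies one overpartition for each set of its distinct part sizes.\<close>

definition overpartition_fps :: "nat set \<Rightarrow> int fps" where
  "overpartition_fps P = Abs_fps (\<lambda>n. \<Sum>M\<in>partitions_in P n. 2 ^ card (set_mset M))"

text \<open>The series (1 + q^j) / (1 - q^j) and j q^j / (1 - q^(2j)), respectively.\<close>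

definition part_fps :: "nat \<Rightarrow> int fps" where
  "part_fps j = Abs_fps (\<lambda>n. if n = 0 then 1 else if j dvd n then 2 else 0)"

definition odd_multiples_fps :: "nat \<Rightarrow> int fps" where
  "odd_multiples_fps j = Abs_fps (\<lambda>n. if j dvd n \<and> odd (n div j) then int j else 0)"

definition odd_sigma_fps :: "int fps" where
  "odd_sigma_fps = Abs_fps (\<lambda>n. if odd n then int (\<Sum>d | d dvd n. d) else 0)"

section \<open>Product formula over a finite set of part sizes\<close>

text \<open>Every partition splits uniquely into its copies of \<open>j\<close> and the rest. The
  index \<open>i\<close> is the total contributed by \<open>j\<close>, not its multiplicity, so that
  the union has the shape of a Cauchy product.\<close>

lemma partitions_in_insert:
  assumes "j \<notin> P" "0 < j"
  shows "partitions_in (insert j P) n =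
    (\<Union>i\<in>{0..n}. if j dvd i then (\<lambda>M. replicate_mset (i div j) j + M) ` partitions_in P (n - i) else {})"
    (is "?L = ?R")
proof (intro equalityI subsetI)
  fix M assume M: "M \<in> ?L"
  define m where "m = count M j"
  define M' where "M' = filter_mset (\<lambda>x. x \<noteq> j) M"
  have "M = filter_mset (\<lambda>x. x = j) M + M'"
    unfolding M'_def by (rule multiset_partition)
  hence eq: "M = replicate_mset m j + M'"
    by (simp add: m_def filter_eq_replicate_mset)
  have sum: "m * j + sum_mset M' = n"
    using M by (subst (asm) eq) (simp add: partitions_in_def)
  have "set_mset M' \<subseteq> P"
    using M by (auto simp: M'_def partitions_in_def)
  hence "M' \<in> partitions_in P (n - m * j)"
    using sum by (auto simp: partitions_in_def)
  moreover have "m * j \<le> n" using sum by simp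
  ultimately show "M \<in> ?R"
    using assms(2) by (intro UN_I[of "m * j"]) (auto simp: eq)
next
  fix M assume "M \<in> ?R"
  then show "M \<in> ?L"
    by (auto simp: partitions_in_def split: if_splits)
qed

lemma finite_partitions_in:
  assumes "finite P" "0 \<notin> P"
  shows "finite (partitions_in P n)"
  using assms
proof (induction P arbitrary: n)
  case empty
  have "partitions_in {} n \<subseteq> {{#}}"
    by (auto simp: partitions_in_def)
  then show ?case by (rule finite_subset) simp
next
  case (insert j P)
  then show ?case by (subst partitions_in_insert) auto
qed

lemma overpartition_fps_empty: "overpartition_fps {} = 1"
proof (rule fps_ext)
  fix n
  have "partitions_in {} n = (if n = 0 then {{#}} else {})"
    by (auto simp: partitions_in_def)
  then show "overpartition_fps {} $ n = 1 $ n"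
    by (simp add: overpartition_fps_def)
qed

text \<open>If \<open>j\<close> is absent, the weight stays the same; if it occurs, with whatever
  multiplicity, there is one more distinct part size and the weight doubles. These factors 1 and 2
  are the nonzero coefficients of \<open>part_fps j\<close>.\<close>

lemma overpartition_fps_insert:
  assumes "finite P" "j \<notin> P" "0 \<notin> insert j P"
  shows "overpartition_fps (insert j P) = part_fps j * overpartition_fps P"
proof (rule fps_ext)
  fix n
  let ?w = "\<lambda>M :: nat multiset. (2::int) ^ card (set_mset M)"
  define U where "U i = (if j dvd i then (\<lambda>M. replicate_mset (i div j) j + M) ` partitions_in P (n - i) else {})" for i
  have j: "0 < j" using assms(3) by auto
  have notin: "j \<notin># M" if "M \<in> partitions_in P m" for M m
    using that assms(2) by (auto simp: partitions_in_def)
  have count: "j dvd i \<and> count M j = i div j" if "M \<in> U i" for M i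
    using that notin by (auto simp: U_def count_eq_zero_iff split: if_splits)
  have fin: "finite (U i)" for i
    using finite_partitions_in[OF assms(1)] assms(3) by (auto simp: U_def)
  \<comment> \<open>The index is recovered from any member of \<open>U i\<close> as \<open>j\<close>
    times the multiplicity of \<open>j\<close>.\<close>
  have disj: "U i \<inter> U i' = {}" if "i \<noteq> i'" for i i'
    using count[of _ i] count[of _ i'] that by (metis disjoint_iff dvd_div_mult_self)
  have U: "sum ?w (U i) = part_fps j $ i * overpartition_fps P $ (n - i)" for i
  proof (cases "j dvd i")
    case True
    have "sum ?w (U i) = (\<Sum>M\<in>partitions_in P (n - i). ?w (replicate_mset (i div j) j + M))"
      using True by (simp add: U_def sum.reindex)
    also have "\<dots> = (\<Sum>M\<in>partitions_in P (n - i). part_fps j $ i * ?w M)"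
    proof (rule sum.cong[OF refl])
      fix M assume M: "M \<in> partitions_in P (n - i)"
      have "i div j = 0 \<longleftrightarrow> i = 0" using True using j by (auto elim!: dvdE)
      then show "?w (replicate_mset (i div j) j + M) = part_fps j $ i * ?w M"
        using True notin[OF M] by (cases "i = 0") (auto simp: part_fps_def)
    qed
    finally show ?thesis
      by (simp add: overpartition_fps_def sum_distrib_left)
  next
    case False
    then have "i \<noteq> 0" by (metis dvd_0_right)
    then show ?thesis using False by (simp add: U_def part_fps_def)
  qed
  have "overpartition_fps (insert j P) $ n = sum ?w (\<Union>i\<in>{0..n}. U i)"
    using partitions_in_insert[OF assms(2) j] by (simp add: overpartition_fps_def U_def)
  also have "\<dots> = (\<Sum>i=0..n. sum ?w (U i))"
    using fin disj by (intro sum.UNION_disjoint) auto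
  also have "\<dots> = (part_fps j * overpartition_fps P) $ n"
    by (simp add: U fps_mult_nth)
  finally show "overpartition_fps (insert j P) $ n = (part_fps j * overpartition_fps P) $ n" .
qed

section \<open>Logarithmic derivatives\<close>

text \<open>Along the multiples of \<open>j\<close> the coefficients are 1, 2, 2, ...; subtracting
  their shift by one place leaves 1, 1, 0, 0, ....\<close>

lemma part_fps_closed_form:
  assumes "0 < j"
  shows "part_fps j * (1 - fps_X ^ j) = 1 + fps_X ^ j"
proof (rule fps_ext)
  fix n
  have "j dvd n - j \<longleftrightarrow> j dvd n" if "j \<le> n"
    using that by (metis dvd_minus_self not_less)
  then show "(part_fps j * (1 - fps_X ^ j)) $ n = (1 + fps_X ^ j) $ n"
    using assms by (auto simp: right_diff_distrib fps_X_power_mult_right_nth part_fps_def dest: dvd_imp_le)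
qed

lemma odd_multiples_fps_closed_form:
  assumes "0 < j"
  shows "odd_multiples_fps j * (1 - fps_X ^ (2 * j)) = of_nat j * fps_X ^ j"
proof (rule fps_ext)
  fix n
  \<comment> \<open>The odd multiples of \<open>j\<close> are \<open>j\<close> itself and the odd
    multiples shifted by \<open>2 * j\<close>, so only the term at \<open>j\<close> survives the
    subtraction.\<close>
  have *: "(j dvd n \<and> odd (n div j)) \<longleftrightarrow> n = j \<or> 2 * j \<le> n \<and> j dvd n - 2 * j \<and> odd ((n - 2 * j) div j)"
  proof (cases "2 * j \<le> n")
    case True
    then obtain m where "n = m + 2 * j" by (metis le_add_diff_inverse2)
    then show ?thesis using assms by auto
  next
    case False
    then have "n div j < 2" using assms by (simp add: div_less_iff_less_mult)
    then show ?thesis using False assms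
      by (auto elim!: dvdE simp: less_2_cases_iff)
  qed
  show "(odd_multiples_fps j * (1 - fps_X ^ (2 * j))) $ n = (of_nat j * fps_X ^ j) $ n"
    using assms * by (auto simp: right_diff_distrib fps_X_power_mult_right_nth odd_multiples_fps_def)
qed

text \<open>This is the logarithmic derivative of (1 + q^j) / (1 - q^j), obtained without division:
  both sides are multiplied by \<open>(1 - X)\<^sup>2\<close>, which can be cancelled because
  integer power series form an integral domain.\<close>

lemma part_fps_deriv:
  assumes "0 < j"
  shows "fps_X * fps_deriv (part_fps j) = 2 * odd_multiples_fps j * part_fps j"
proof -
  define c D X where "c = part_fps j" and "D = odd_multiples_fps j" and "X = (fps_X ^ j :: int fps)"
  have c: "c * (1 - X) = 1 + X"
    using part_fps_closed_form[OF assms] by (simp add: c_def X_def)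
  have D: "D * (1 - X\<^sup>2) = of_nat j * X"
    using odd_multiples_fps_closed_form[OF assms] by (simp add: D_def X_def power_mult[symmetric] mult.commute)
  have X: "fps_X * fps_deriv X = of_nat j * X"
  proof (rule fps_ext)
    fix n
    show "(fps_X * fps_deriv X) $ n = (of_nat j * X) $ n"
      by (cases n) (auto simp: X_def)
  qed
  \<comment> \<open>Differentiating the relation \<open>c * (1 - X) = 1 + X\<close> takes the place
    of the quotient rule.\<close>
  have "fps_X * fps_deriv c * (1 - X) - c * (fps_X * fps_deriv X) = fps_X * fps_deriv (c * (1 - X))"
    by (simp add: algebra_simps)
  also have "\<dots> = fps_X * fps_deriv X"
    by (simp add: c)
  finally have "fps_X * fps_deriv c * (1 - X) = of_nat j * X * (1 + c)"
    unfolding X by (simp only: diff_eq_eq distrib_left mult_1_left mult_1_right mult_ac)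
  hence "fps_X * fps_deriv c * (1 - X) * (1 - X) = of_nat j * X * (1 + c) * (1 - X)"
    by (rule arg_cong)
  hence "fps_X * fps_deriv c * (1 - X)\<^sup>2 = of_nat j * X * ((1 - X) + c * (1 - X))"
    by (simp only: power2_eq_square mult.assoc distrib_right mult_1_left)
  also have "\<dots> = 2 * (D * (1 - X\<^sup>2))"
    unfolding c D by simp
  also have "\<dots> = 2 * D * c * (1 - X)\<^sup>2"
  proof -
    \<comment> \<open>Here the factor \<open>1 + X\<close> of the difference of squares is replaced
      by \<open>c * (1 - X)\<close>.\<close>
    have "1 - X\<^sup>2 = (1 - X) * (c * (1 - X))"
      unfolding c by (simp add: power2_eq_square algebra_simps)
    then show ?thesis by (simp add: power2_eq_square mult_ac)
  qed
  finally have "fps_X * fps_deriv c * (1 - X)\<^sup>2 = 2 * D * c * (1 - X)\<^sup>2" .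
  moreover have "1 - X \<noteq> 0"
  proof
    assume "1 - X = 0"
    hence "(1 - X) $ 0 = 0" by simp
    then show False using assms by (simp add: X_def)
  qed
  ultimately show ?thesis by (simp add: c_def D_def)
qed

text \<open>The logarithmic derivative of a product is the sum of those of its factors.\<close>

lemma overpartition_fps_deriv:
  assumes "finite P" "0 \<notin> P"
  shows "fps_X * fps_deriv (overpartition_fps P) =
    2 * (\<Sum>j\<in>P. odd_multiples_fps j) * overpartition_fps P"
  using assms
proof (induction P)
  case empty
  then show ?case by (simp add: overpartition_fps_empty)
next
  case (insert j P)
  define c D A S where "c = part_fps j" and "D = odd_multiples_fps j"
    and "A = overpartition_fps P" and "S = (\<Sum>j\<in>P. odd_multiples_fps j)"
  have c: "fps_X * fps_deriv c = 2 * D * c"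
    using insert.prems by (simp add: c_def D_def part_fps_deriv)
  have A: "fps_X * fps_deriv A = 2 * S * A"
    using insert by (simp add: A_def S_def)
  have "fps_X * fps_deriv (c * A) = (fps_X * fps_deriv c) * A + c * (fps_X * fps_deriv A)"
    by (simp add: algebra_simps)
  also have "\<dots> = 2 * (D + S) * (c * A)"
    unfolding c A by (simp add: algebra_simps)
  finally show ?case
    using insert by (simp add: overpartition_fps_insert c_def D_def A_def S_def)
qed

section \<open>From finite sets of part sizes to all odd part sizes\<close>

text \<open>No part exceeds the sum. Hence each coefficient of the infinite product over odd part
  sizes is already a coefficient of a finite product.\<close>

lemma partitions_in_odd_trunc:
  assumes "n \<le> N"
  shows "partitions_in {j. odd j} n = partitions_in {j. odd j \<and> j \<le> N} n"
proof -
  have "x \<le> N" if "x \<in># M" "sum_mset M = n" for x M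
    using sum_mset.remove[OF that(1)] that(2) assms by simp
  then show ?thesis by (auto simp: partitions_in_def)
qed

lemma overpartition_fps_odd_trunc:
  assumes "n \<le> N"
  shows "overpartition_fps {j. odd j} $ n = overpartition_fps {j. odd j \<and> j \<le> N} $ n"
  by (simp add: overpartition_fps_def partitions_in_odd_trunc[OF assms])

lemma finite_partitions_in_odd: "finite (partitions_in {j. odd j} n)"
  by (simp add: partitions_in_odd_trunc[OF order_refl] finite_partitions_in)

text \<open>For odd \<open>n\<close> all divisors and their codivisors are odd, so each divisor
  \<open>j\<close> contributes \<open>j\<close>. For even \<open>n\<close>, including 0, an odd
  divisor has an even codivisor and nothing contributes.\<close>

lemma sum_odd_multiples_fps:
  assumes "n \<le> N"
  shows "(\<Sum>j | odd j \<and> j \<le> N. odd_multiples_fps j) $ n = odd_sigma_fps $ n"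
proof -
  have "(\<Sum>j | odd j \<and> j \<le> N. odd_multiples_fps j $ n) =
      (\<Sum>j | odd j \<and> j \<le> N \<and> j dvd n \<and> odd (n div j). int j)"
    by (intro sum.mono_neutral_cong_right) (auto simp: odd_multiples_fps_def)
  also have "\<dots> = odd_sigma_fps $ n"
  proof (cases "odd n")
    case True
    then have "0 < n" by (cases n) auto
    have "{j. odd j \<and> j \<le> N \<and> j dvd n \<and> odd (n div j)} = {j. j dvd n}"
      using True assms dvd_imp_le[OF _ \<open>0 < n\<close>] by (force elim: dvdE)
    then show ?thesis using True by (simp add: odd_sigma_fps_def)
  next
    case False
    have "even (n div j)" if "odd j" "j dvd n" for j
    proof -
      have "even (j * (n div j))" using False that(2) by simp
      then show ?thesis using that(1) by (simp only: even_mult_iff) simp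
    qed
    then have "{j. odd j \<and> j \<le> N \<and> j dvd n \<and> odd (n div j)} = {}"
      by blast
    then have "(\<Sum>j | odd j \<and> j \<le> N \<and> j dvd n \<and> odd (n div j). int j) = 0"
      by (simp only: sum.empty)
    then show ?thesis using False by (simp add: odd_sigma_fps_def)
  qed
  finally show ?thesis by (simp add: fps_sum_nth)
qed

text \<open>The coefficients at \<open>n\<close> on both sides involve only coefficients up to
  \<open>n\<close> of the two series, so the finite case with part sizes up to \<open>n\<close>
  suffices.\<close>

lemma overpartition_fps_odd_deriv:
  "fps_X * fps_deriv (overpartition_fps {j. odd j}) =
    2 * odd_sigma_fps * overpartition_fps {j. odd j}" (is "?L = ?R")
proof (rule fps_ext)
  fix n :: nat
  define P where "P = {j. odd j \<and> j \<le> n}"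
  have A: "overpartition_fps {j. odd j} $ m = overpartition_fps P $ m" if "m \<le> n" for m
    using overpartition_fps_odd_trunc[OF that] by (simp add: P_def)
  have S: "odd_sigma_fps $ m = (\<Sum>j\<in>P. odd_multiples_fps j) $ m" if "m \<le> n" for m
    using sum_odd_multiples_fps[OF that] by (simp add: P_def)
  have "?L $ n = (fps_X * fps_deriv (overpartition_fps P)) $ n"
    using A[of n] by (cases n) simp_all
  also have "\<dots> = (2 * ((\<Sum>j\<in>P. odd_multiples_fps j) * overpartition_fps P)) $ n"
    by (subst overpartition_fps_deriv) (simp_all add: P_def mult.assoc)
  also have "\<dots> = (2 * (odd_sigma_fps * overpartition_fps {j. odd j})) $ n"
    unfolding mult_2 fps_add_nth fps_mult_nth using A S by (simp cong: sum.cong_simp)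
  finally show "?L $ n = ?R $ n" by (simp add: mult.assoc)
qed

section \<open>The generating function modulo 2 and its even powers modulo 4\<close>

text \<open>Every nonempty partition has a positive number of distinct part sizes and hence even
  weight; the empty one has weight 1.\<close>

lemma overpartition_fps_odd_mod_2: "\<exists>G. overpartition_fps {j. odd j} = 1 + 2 * G"
proof -
  define G :: "int fps" where "G = Abs_fps (\<lambda>n. (overpartition_fps {j. odd j} - 1) $ n div 2)"
  have "even ((overpartition_fps {j. odd j} - 1) $ n)" for n
  proof (cases "n = 0")
    case True
    have "M = {#}" if "M \<in> partitions_in {j. odd j} 0" for M
    proof (rule ccontr)
      assume "M \<noteq> {#}"
      then obtain x where "x \<in># M" by (meson multiset_nonemptyE)
      then show False using that by (auto simp: partitions_in_def)
    qed
    hence "partitions_in {j. odd j} 0 = {{#}}"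
      by (auto simp: partitions_in_def)
    then show ?thesis using True by (simp add: overpartition_fps_def)
  next
    case False
    have "even ((2::int) ^ card (set_mset M))" if "M \<in> partitions_in {j. odd j} n" for M
      using that False by (auto simp: partitions_in_def card_gt_0_iff)
    then show ?thesis using False
      by (auto simp: overpartition_fps_def intro: dvd_sum)
  qed
  hence "G $ n + G $ n = (overpartition_fps {j. odd j} - 1) $ n" for n
    unfolding G_def fps_nth_Abs_fps by (metis dvd_mult_div_cancel mult_2)
  hence "2 * G = overpartition_fps {j. odd j} - 1"
    unfolding mult_2 by (intro fps_ext) (simp only: fps_add_nth)
  then show ?thesis by (intro exI[of _ G]) (simp add: algebra_simps)
qed

lemma overpartition_fps_odd_power_mod_4:
  assumes "even k"
  shows "\<exists>H. overpartition_fps {j. odd j} ^ k = 1 + 4 * H"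
proof -
  obtain l where l: "k = 2 * l" using assms by blast
  obtain G where G: "overpartition_fps {j. odd j} = 1 + 2 * G"
    using overpartition_fps_odd_mod_2 by blast
  define K where "K = G + G\<^sup>2"
  \<comment> \<open>Squaring \<open>1 + 2 * G\<close> gains a factor 2 in the modulus; this is where
    the evenness of \<open>k\<close> enters.\<close>
  have "overpartition_fps {j. odd j} ^ 2 = 1 + 4 * K"
    unfolding G K_def by (simp add: power2_eq_square algebra_simps)
  moreover have "\<exists>H. (1 + 4 * K) ^ l = 1 + 4 * H"
  proof (induction l)
    case 0
    show ?case by (intro exI[of _ 0]) simp
  next
    case (Suc l)
    then obtain H where "(1 + 4 * K) ^ l = 1 + 4 * H" by blast
    then show ?case
      by (intro exI[of _ "H + K + 4 * K * H"]) (simp add: algebra_simps)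
  qed
  ultimately show ?thesis by (simp add: l power_mult)
qed

section \<open>Tuples as powers of the generating function\<close>

definition odd_overpartitions :: "nat \<Rightarrow> overpartition set" where
  "odd_overpartitions n = {\<xi>. is_overpartition \<xi> \<and> all_parts_odd \<xi> \<and> sum_mset (fst \<xi>) = n}"

lemma odd_overpartitions_eq:
  "odd_overpartitions n = Sigma (partitions_in {j. odd j} n) (\<lambda>M. Pow (set_mset M))"
proof (rule set_eqI)
  fix \<xi> :: overpartition
  have "(\<forall>p\<in>#M. 0 < p) \<and> (\<forall>p\<in>#M. odd p) \<longleftrightarrow> set_mset M \<subseteq> {j. odd j}" for M :: "nat multiset"
    using odd_pos by blast
  then show "\<xi> \<in> odd_overpartitions n \<longleftrightarrow> \<xi> \<in> Sigma (partitions_in {j. odd j} n) (\<lambda>M. Pow (set_mset M))"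
    unfolding odd_overpartitions_def is_overpartition_def all_parts_odd_def partitions_in_def
      mem_Collect_eq mem_Sigma_iff mem_Times_iff Sigma_def by (cases \<xi>) auto
qed

lemma finite_odd_overpartitions: "finite (odd_overpartitions n)"
  unfolding odd_overpartitions_eq by (intro finite_SigmaI finite_partitions_in_odd) simp

lemma card_odd_overpartitions: "int (card (odd_overpartitions n)) = overpartition_fps {j. odd j} $ n"
  by (simp add: odd_overpartitions_eq overpartition_fps_def finite_partitions_in_odd card_Pow)

text \<open>Tuples are sorted by the sum \<open>m\<close> of their first component, which turns the
  count into a Cauchy product and gives powers of the series by induction on
  \<open>k\<close>.\<close>

lemma odd_overpartition_tuples_Suc:
  "odd_overpartition_tuples (Suc k) n =
    (\<Union>m\<in>{0..n}. (\<lambda>(\<xi>, \<xi>s). \<xi> # \<xi>s) ` (odd_overpartitions m \<times> odd_overpartition_tuples k (n - m)))"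
    (is "?L = ?R")
proof (intro equalityI subsetI)
  fix x assume x: "x \<in> ?L"
  then obtain \<xi> \<xi>s where "x = \<xi> # \<xi>s"
    by (auto simp: odd_overpartition_tuples_def length_Suc_conv)
  then show "x \<in> ?R"
    using x by (intro UN_I[of "sum_mset (fst \<xi>)"])
      (auto simp: odd_overpartition_tuples_def odd_overpartitions_def)
next
  fix x assume "x \<in> ?R"
  then show "x \<in> ?L"
    by (auto simp: odd_overpartition_tuples_def odd_overpartitions_def)
qed

lemma OPT_fps: "int (OPT k n) = (overpartition_fps {j. odd j} ^ k) $ n"
proof (induction k arbitrary: n)
  case 0
  have "odd_overpartition_tuples 0 n = (if n = 0 then {[]} else {})"
    by (auto simp: odd_overpartition_tuples_def)
  then show ?case by (simp add: OPT_def)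
next
  case (Suc k)
  let ?U = "\<lambda>m. (\<lambda>(\<xi>, \<xi>s). \<xi> # \<xi>s) ` (odd_overpartitions m \<times> odd_overpartition_tuples k (n - m))"
  have disj: "m = m'" if "\<xi> \<in> odd_overpartitions m" "\<xi> \<in> odd_overpartitions m'" for \<xi> m m'
    using that by (simp add: odd_overpartitions_def)
  have "OPT (Suc k) n = (\<Sum>m=0..n. card (?U m))"
    unfolding OPT_def odd_overpartition_tuples_Suc
    by (intro card_UN_disjoint)
      (auto simp: finite_odd_overpartitions finite_odd_overpartition_tuples dest: disj)
  also have "\<dots> = (\<Sum>m=0..n. card (odd_overpartitions m) * OPT k (n - m))"
    by (intro sum.cong refl, subst card_image)
      (auto simp: inj_on_def card_cartesian_product OPT_def)
  finally show ?case
    by (simp add: fps_mult_nth Suc card_odd_overpartitions)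
qed

section \<open>Reduction to divisor sums\<close>

text \<open>The term \<open>4 * t\<close> comes from the part \<open>4 * H\<close> of the
  \<open>k\<close>-th power, so the second factor on the right is known modulo 4 from the divisor
  sum alone.\<close>

lemma OPT_even_tuple_recurrence:
  assumes "even k" "odd n"
  shows "\<exists>t. int n * int (OPT k n) = 2 * int k * (int (\<Sum>d | d dvd n. d) + 4 * t)"
proof -
  let ?A = "overpartition_fps {j. odd j}"
  obtain H where H: "?A ^ k = 1 + 4 * H"
    using overpartition_fps_odd_power_mod_4[OF assms(1)] by blast
  have "fps_X * fps_deriv (?A ^ k) = of_nat k * ?A ^ (k - 1) * (fps_X * fps_deriv ?A)"
    by (simp add: fps_deriv_power fps_of_nat mult_ac)
  \<comment> \<open>The factor \<open>?A\<close> from the derivative restores the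
    \<open>k\<close>-th power. For \<open>k = 0\<close>, where \<open>k - 1\<close> truncates, both
    sides vanish.\<close>
  also have "\<dots> = of_nat (2 * k) * (odd_sigma_fps * ?A ^ k)"
    unfolding overpartition_fps_odd_deriv by (cases k) (simp_all add: mult_ac)
  also have "\<dots> = of_nat (2 * k) * (odd_sigma_fps + of_nat 4 * (odd_sigma_fps * H))"
    unfolding H by (simp add: algebra_simps)
  finally have "(fps_X * fps_deriv (?A ^ k)) $ n = \<dots> $ n" by simp
  moreover have "(fps_X * fps_deriv (?A ^ k)) $ n = int n * int (OPT k n)"
    using assms(2) by (cases n) (simp_all add: OPT_fps)
  ultimately have "int n * int (OPT k n) = 2 * int k * (odd_sigma_fps $ n + 4 * (odd_sigma_fps * H) $ n)"
    unfolding fps_of_nat[symmetric] by simp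
  then show ?thesis using assms(2) by (auto simp: odd_sigma_fps_def)
qed

section \<open>Divisor sums modulo 4 and 2\<close>

text \<open>The involution sending \<open>d\<close> to \<open>n div d\<close> exchanges the divisors
  with \<open>Q\<close> and those without, so \<open>Q\<close> selects one member of each
  pair.\<close>

lemma divisor_sum_pairing:
  fixes n :: nat
  assumes "0 < n" "\<And>d. d dvd n \<Longrightarrow> Q (n div d) \<longleftrightarrow> \<not> Q d"
  shows "(\<Sum>d | d dvd n. d) = (\<Sum>d | d dvd n \<and> Q d. d + n div d)"
proof -
  have "(\<Sum>d | d dvd n. d) = (\<Sum>d | d dvd n \<and> Q d. d) + (\<Sum>d | d dvd n \<and> \<not> Q d. d)"
    using assms(1) by (subst sum.union_disjoint[symmetric]) (auto intro: sum.cong)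
  also have "(\<Sum>d | d dvd n \<and> \<not> Q d. d) = (\<Sum>d | d dvd n \<and> Q d. n div d)"
    using assms by (intro sum.reindex_bij_witness[of _ "\<lambda>d. n div d" "\<lambda>d. n div d"])
      (auto simp: div_dvd_iff_mult)
  finally show ?thesis by (simp add: sum.distrib)
qed

text \<open>Two codivisors have residues with product 3 modulo 4, so one is 1 and the other 3, and
  their sum is divisible by 4.\<close>

lemma four_dvd_divisor_sum:
  fixes n :: nat
  assumes "n mod 4 = 3"
  shows "4 dvd (\<Sum>d | d dvd n. d)"
proof -
  have pair: "d mod 4 = 1 \<and> n div d mod 4 = 3 \<or> d mod 4 = 3 \<and> n div d mod 4 = 1" if "d dvd n" for d
  proof -
    have "(d mod 4) * (n div d mod 4) mod 4 = 3"
      using that assms by (simp add: mod_mult_eq)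
    moreover have "d mod 4 \<in> {0,1,2,3}" "n div d mod 4 \<in> {0,1,2,3}" by auto
    ultimately show ?thesis by auto
  qed
  have "0 < n" using assms by (cases n) auto
  hence "(\<Sum>d | d dvd n. d) = (\<Sum>d | d dvd n \<and> d mod 4 = 1. d + n div d)"
    using pair by (intro divisor_sum_pairing) fastforce+
  also have "4 dvd \<dots>"
  proof (intro dvd_sum)
    fix d assume "d \<in> {d. d dvd n \<and> d mod 4 = 1}"
    then have "d mod 4 = 1" "n div d mod 4 = 3" using pair[of d] by auto
    then have "(d mod 4 + n div d mod 4) mod 4 = 0" by simp
    then show "4 dvd d + n div d" by (simp only: mod_add_eq mod_eq_0_iff_dvd)
  qed
  finally show ?thesis .
qed

text \<open>As 5 is not a square modulo 8, no divisor is its own codivisor. The smaller member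
  selects each pair, and a pair of odd numbers has even sum.\<close>

lemma even_divisor_sum:
  fixes n :: nat
  assumes "n mod 8 = 5"
  shows "even (\<Sum>d | d dvd n. d)"
proof -
  have n: "0 < n" "odd n" using assms by presburger+
  have sq: "d * d \<noteq> n" for d
  proof
    assume "d * d = n"
    hence "(d mod 8) * (d mod 8) mod 8 = 5" using assms by (simp add: mod_mult_eq)
    moreover have "d mod 8 \<in> {0,1,2,3,4,5,6,7}" by auto
    ultimately show False by auto
  qed
  have "(\<Sum>d | d dvd n. d) = (\<Sum>d | d dvd n \<and> d < n div d. d + n div d)"
  proof (intro divisor_sum_pairing n)
    fix d assume "d dvd n"
    then show "(n div d < n div (n div d)) \<longleftrightarrow> \<not> d < n div d"
      using n sq[of d] by (auto elim!: dvdE)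
  qed
  also have "even \<dots>"
    using n by (intro dvd_sum) (auto elim!: dvdE)
  finally show ?thesis .
qed

section \<open>Powers of 2 dividing the counts\<close>

text \<open>The exponent \<open>i + 1\<close> comes from the factor \<open>2 * k\<close> with
  \<open>k = 2 ^ i * r\<close>, and \<open>s\<close> from the divisor sum, capped at 2 by the term
  \<open>4 * t\<close>. The odd factor \<open>n\<close> is coprime to the modulus and
  cancels.\<close>

lemma OPT_cong_0:
  assumes "i \<ge> 1" "odd n" "2 ^ s dvd (\<Sum>d | d dvd n. d)" "s \<le> 2"
  shows "[OPT (2 ^ i * r) n = 0] (mod 2 ^ (i + 1 + s))"
proof -
  obtain t where t: "int n * int (OPT (2 ^ i * r) n) =
      2 * int (2 ^ i * r) * (int (\<Sum>d | d dvd n. d) + 4 * t)"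
    using OPT_even_tuple_recurrence[of "2 ^ i * r" n] assms by auto
  have "(2::int) ^ s dvd 2\<^sup>2" using assms(4) by (rule le_imp_power_dvd)
  moreover have "(2::int) ^ s dvd int (\<Sum>d | d dvd n. d)"
    using assms(3) by (metis of_nat_dvd_iff of_nat_numeral of_nat_power)
  ultimately have "(2::int) ^ s dvd int (\<Sum>d | d dvd n. d) + 4 * t"
    by (intro dvd_add dvd_mult2) auto
  moreover have "(2::int) ^ (i + 1) dvd 2 * int (2 ^ i * r)" by simp
  ultimately have "(2::int) ^ (i + 1 + s) dvd int n * int (OPT (2 ^ i * r) n)"
    unfolding t power_add[of _ "i + 1"] by (intro mult_dvd_mono)
  moreover have "coprime ((2::int) ^ (i + 1 + s)) (int n)"
    using assms(2) by simp
  ultimately have "int (2 ^ (i + 1 + s)) dvd int (OPT (2 ^ i * r) n)"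
    by (simp add: coprime_dvd_mult_right_iff)
  then show ?thesis by (simp only: of_nat_dvd_iff cong_0_iff)
qed

theorem theorem1p5:
  fixes i n r :: nat
  assumes "i \<ge> 1" and "odd r"
  shows "[OPT (2 ^ i * r) (8 * n + 1) = 0] (mod 2 ^ (i + 1)) \<and>
         [OPT (2 ^ i * r) (4 * n + 3) = 0] (mod 2 ^ (i + 3)) \<and>
         [OPT (2 ^ i * r) (8 * n + 5) = 0] (mod 2 ^ (i + 2))"
proof (intro conjI)
  \<comment> \<open>The three progressions use \<open>s\<close> equal to 0, 2 and 1, in this
    order.\<close>
  show "[OPT (2 ^ i * r) (8 * n + 1) = 0] (mod 2 ^ (i + 1))"
    using OPT_cong_0[OF assms(1), of "8 * n + 1" 0] by simp
  have "(2::nat)\<^sup>2 dvd (\<Sum>d | d dvd 4 * n + 3. d)"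
    using four_dvd_divisor_sum[of "4 * n + 3"] by simp
  from OPT_cong_0[OF assms(1) _ this]
  show "[OPT (2 ^ i * r) (4 * n + 3) = 0] (mod 2 ^ (i + 3))"
    by (simp add: power_add mult.commute)
  have "(2::nat) ^ 1 dvd (\<Sum>d | d dvd 8 * n + 5. d)"
    using even_divisor_sum[of "8 * n + 5"] by simp
  from OPT_cong_0[OF assms(1) _ this]
  show "[OPT (2 ^ i * r) (8 * n + 5) = 0] (mod 2 ^ (i + 2))"
    by (simp add: power_add mult.commute)
qed

end
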